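(* Let $G(n,m)=(V_\alpha\cup V_\beta,E)$ be a bipartite graph with $m\ge n$ and let $k^*$ be an integer with $0\le k^*\le m-1$ such that the degree of strong resilience of $G$ is less than $k^*$. Let $P^*$ be a fair $b$-matching (with respect to $G$ and $k^*$). Then: (1) the graph $G^*(n,m):=(V_\alpha\cup V_\beta,E\cup P^* )$ is strongly $k^*$-resilient; (2) the minimal number of edges out of the complement $G^c(n,m)$ that one needs to add to $G(n,m)$ to obtain a strongly $k^*$-resilient graph is $\delta^*:=|P^*|-|P^*\cap E|$.
   Context: $G(n,m)=(V_\alpha\cup V_\beta,E)$ is an undirected bipartite graph with left-nodes $V_\alpha=\{\alpha_1,\dots,\alpha_n\}$ and right-nodes $V_\beta=\{\beta_1,\dots,\beta_m\}$. $K=(V_\alpha\cup V_\beta,E_K)$ is the complete bipartite graph on these nodes and $G^c=(V_\alpha\cup V_\beta,E_K- E)$ is the complement of $G$. A $b$-matching is a subset $P\subseteq E_K$ such that each node $v\in V_\alpha\cup V_\beta$ is incident to at most $k^*+1$ edges of $P$. A fair $b$-matching is a $b$-matching $P$ of maximal cardinality such that $|P\cap E|$ is maximal (among all $b$-matchings of maximal cardinality). Strong resilience: a sparsity pattern $\mathcal S(n,m)$ in $\mathbb R^{n\times m}$ is a vector subspace with a basis consisting of matrices $E_{ij}$ ($1$ in entry $(i,j)$, $0$ elsewhere); $E(\mathcal S)$ is the set of pairs $(i,j)$ with $E_{ij}\in\mathcal S$; its rank is the maximal rank of matrices in it. It corresponds bijectively to the bipartite graph with edges $(\alpha_i,\beta_j)$,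 $(i,j)\in E(\mathcal S)$. A pattern of rank $n$ is $0$-resilient if there is a pattern $\mathcal S'$ with $E(\mathcal S')\subset E(\mathcal S)$, $|E(\mathcal S')|=|E(\mathcal S)|-1$, of rank less than $n$. A pattern of rank $n$ is (exactly) strongly $k$-resilient, i.e. has degree of strong resilience $k\ge0$, if it contains a direct sum (pairwise disjoint index sets) of $k+1$, but not of $k+2$, $0$-resilient patterns; the degree of strong resilience is $-1$ by convention if the rank is less than $n$. These notions for a graph are those of the corresponding pattern. *)

theory Defs
  imports "HOL-Analysis.Analysis"
begin

text \<open>
  The left-nodes are the elements of \<open>'n\<close> and the right-nodes those of \<open>'m\<close>, so that
  \<open>CARD('n)\<close> is \<open>n\<close>, \<open>CARD('m)\<close> is \<open>m\<close> (both at least 1), and an \<open>n \<times> m\<close> matrix has type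
  \<open>real^'m^'n\<close>. A bipartite graph on these nodes is given by its edge set: the undirected
  edge joining \<open>\<alpha>\<^sub>i\<close> and \<open>\<beta>\<^sub>j\<close> is the pair \<open>(i, j)\<close>.
\<close>

definition unit_matrix :: "'n::finite \<times> 'm::finite \<Rightarrow> real^'m^'n" where
  "unit_matrix e = axis (fst e) (axis (snd e) 1)"

lemma unit_matrix_nth: "unit_matrix (i, j) $ r $ c = (if r = i \<and> c = j then 1 else 0)"
  by (auto simp: unit_matrix_def axis_def)

definition sparsity_pattern :: "(real^'m::finite^'n::finite) set \<Rightarrow> bool" where
  "sparsity_pattern S \<longleftrightarrow>
     subspace S \<and> (\<exists>B. B \<subseteq> range unit_matrix \<and> independent B \<and> span B = S)"

definition index_set :: "(real^'m::finite^'n::finite) set \<Rightarrow> ('n \<times> 'm) set" where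
  "index_set S = {e. unit_matrix e \<in> S}"

text \<open>\<open>S\<close> is infinite in general, but \<open>rank ` S\<close> is a finite set, since ranks are bounded.\<close>

definition pattern_rank :: "(real^'m::finite^'n::finite) set \<Rightarrow> nat" where
  "pattern_rank S = Max (rank ` S)"

definition zero_resilient :: "(real^'m::finite^'n::finite) set \<Rightarrow> bool" where
  "zero_resilient S \<longleftrightarrow>
     sparsity_pattern S \<and> pattern_rank S = CARD('n) \<and>
     (\<exists>S' :: (real^'m^'n) set. sparsity_pattern S' \<and> index_set S' \<subseteq> index_set S \<and>
        card (index_set S') + 1 = card (index_set S) \<and> pattern_rank S' < CARD('n))"

text \<open>The span of the union is the sum of the subspaces \<open>T i\<close>; it is direct because their
  index sets are pairwise disjoint.\<close>

definition contains_direct_sum :: "nat \<Rightarrow> (real^'m::finite^'n::finite) set \<Rightarrow> bool" where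
  "contains_direct_sum q S \<longleftrightarrow>
     (\<exists>T :: nat \<Rightarrow> (real^'m^'n) set.
        (\<forall>i<q. zero_resilient (T i)) \<and>
        disjoint_family_on (\<lambda>i. index_set (T i)) {..<q} \<and>
        span (\<Union>i<q. T i) \<subseteq> S)"

definition strongly_resilient :: "nat \<Rightarrow> (real^'m::finite^'n::finite) set \<Rightarrow> bool" where
  "strongly_resilient k S \<longleftrightarrow>
     sparsity_pattern S \<and> pattern_rank S = CARD('n) \<and>
     contains_direct_sum (k + 1) S \<and> \<not> contains_direct_sum (k + 2) S"

text \<open>A pattern of rank \<open>n\<close> is strongly \<open>k\<close>-resilient for exactly one \<open>k\<close>: the number of disjoint
  0-resilient patterns it contains is positive and bounded by the number of its indices.\<close>

definition strong_resilience_degree :: "(real^'m::finite^'n::finite) set \<Rightarrow> int" where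
  "strong_resilience_degree S =
     (if pattern_rank S < CARD('n) then -1 else int (THE k. strongly_resilient k S))"

lemma contains_direct_sum_mono:
  assumes "contains_direct_sum q S" and "p \<le> q"
  shows "contains_direct_sum p S"
proof -
  obtain T where T: "\<forall>i<q. zero_resilient (T i)"
      "disjoint_family_on (\<lambda>i. index_set (T i)) {..<q}" "span (\<Union>i<q. T i) \<subseteq> S"
    using assms(1) unfolding contains_direct_sum_def by blast
  have "span (\<Union>i<p. T i) \<subseteq> span (\<Union>i<q. T i)"
    using assms(2) by (intro span_mono) force
  then show ?thesis
    unfolding contains_direct_sum_def using T assms(2)
    by (intro exI[of _ T]) (auto simp: disjoint_family_on_def)
qed

lemma strong_resilience_degree_eq:
  assumes "strongly_resilient k S"
  shows "strong_resilience_degree S = int k"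
proof -
  have "j = k" if "strongly_resilient j S" for j
  proof (rule ccontr)
    assume "j \<noteq> k"
    then have "j + 2 \<le> k + 1 \<or> k + 2 \<le> j + 1" by auto
    then show False
      using that assms contains_direct_sum_mono unfolding strongly_resilient_def by blast
  qed
  then have "(THE k. strongly_resilient k S) = k"
    using assms by blast
  then show ?thesis
    using assms by (simp add: strong_resilience_degree_def strongly_resilient_def)
qed

definition graph_pattern :: "('n::finite \<times> 'm::finite) set \<Rightarrow> (real^'m^'n) set" where
  "graph_pattern E = span (unit_matrix ` E)"

lemma index_set_graph_pattern:
  fixes E :: "('n::finite \<times> 'm::finite) set"
  shows "index_set (graph_pattern E) = E"
proof -
  have "e \<in> E" if "unit_matrix e \<in> span (unit_matrix ` E)" for e
  proof (rule ccontr)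
    assume "e \<notin> E"
    then have sub: "unit_matrix ` E \<subseteq> {A. A $ fst e $ snd e = 0}"
      by (auto simp: unit_matrix_def axis_def prod_eq_iff)
    have "subspace {A :: real^'m^'n. A $ fst e $ snd e = 0}"
      by (auto simp: subspace_def)
    then have "unit_matrix e $ fst e $ snd e = 0"
      using span_minimal[OF sub] that by auto
    then show False
      using unit_matrix_nth[of "fst e" "snd e" "fst e" "snd e"] by simp
  qed
  then show ?thesis
    by (auto simp: index_set_def graph_pattern_def intro: span_base)
qed

definition complete_edges :: "('n::finite \<times> 'm::finite) set" where
  "complete_edges = UNIV \<times> UNIV"

definition complement_edges :: "('n::finite \<times> 'm::finite) set \<Rightarrow> ('n \<times> 'm) set" where
  "complement_edges E = complete_edges - E"

definition incident :: "'n + 'm \<Rightarrow> 'n \<times> 'm \<Rightarrow> bool" where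
  "incident v e \<longleftrightarrow> v = Inl (fst e) \<or> v = Inr (snd e)"

text \<open>The capacity of every node is \<open>k + 1\<close>, not \<open>k\<close>.\<close>

definition b_matching :: "nat \<Rightarrow> ('n::finite \<times> 'm::finite) set \<Rightarrow> bool" where
  "b_matching k P \<longleftrightarrow> P \<subseteq> complete_edges \<and> (\<forall>v. card {e \<in> P. incident v e} \<le> k + 1)"

definition maximum_b_matching :: "nat \<Rightarrow> ('n::finite \<times> 'm::finite) set \<Rightarrow> bool" where
  "maximum_b_matching k P \<longleftrightarrow> is_arg_max card (b_matching k) P"

definition fair_b_matching ::
    "nat \<Rightarrow> ('n::finite \<times> 'm::finite) set \<Rightarrow> ('n \<times> 'm) set \<Rightarrow> bool" where
  "fair_b_matching k E P \<longleftrightarrow> is_arg_max (\<lambda>Q. card (Q \<inter> E)) (maximum_b_matching k) P"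

end

theory Submission imports Defs begin

text \<open>
  Write \<open>n = CARD('n)\<close>, \<open>m = CARD('m)\<close>. The proof translates resilience into the degrees of
  subgraphs, after which the theorem is an exchange argument.

  A pattern has rank \<open>n\<close> iff its graph has a matching that saturates all left-nodes
  (\<open>pattern_rank_full_iff\<close>), and the pattern of such a matching is itself 0-resilient. So a
  pattern contains a direct sum of \<open>q\<close> 0-resilient patterns iff its graph contains \<open>q\<close> pairwise
  disjoint left-saturating matchings. By an edge colouring argument in the style of Koenig
  (\<open>left_regular_decompose\<close>), this holds iff the graph has a subgraph in which every left-node has
  degree exactly \<open>q\<close> and every right-node degree at most \<open>q\<close>; call it left-\<open>q\<close>-regular. This is
  \<open>contains_direct_sum_iff\<close>. Since \<open>n \<le> m\<close> and \<open>k + 1 \<le> m\<close>, the maximum \<open>b\<close>-matchings are exactly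
  the left-\<open>(k + 1)\<close>-regular graphs (\<open>maximum_b_matching_iff\<close>), and as they all have the same
  size, a fair one \<open>P\<close> is one with the fewest edges outside \<open>E\<close>.

  Hence \<open>E \<union> P\<close> contains \<open>k + 1\<close> disjoint matchings, and any set \<open>F\<close> whose addition achieves this
  has at least \<open>|P - E|\<close> elements. It remains to see that \<open>E \<union> P\<close> does not contain \<open>k + 2\<close> of them.
  If it did, then deleting any one of the \<open>k + 2\<close> matchings would leave a
  left-\<open>(k + 1)\<close>-regular graph, whose edges outside \<open>E\<close> lie in \<open>P - E\<close> and, by fairness, fill it.
  So no edge of \<open>P - E\<close> lies in the deleted matching, whichever that is, although every such edge
  lies in one of the matchings. Thus \<open>P - E\<close> is empty; but \<open>P \<subseteq> E\<close> contradicts the bound on the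
  degree of resilience of \<open>E\<close>.
\<close>

section \<open>Hall's marriage theorem\<close>

text \<open>
  The induction of Halmos and Vaughan: if some proper nonempty subfamily is tight (its union is
  no larger than the subfamily), represent it first and remove its union from the other sets;
  otherwise there is slack everywhere, and any one set may be given an arbitrary element.
\<close>

theorem hall_system_of_distinct_representatives:
  fixes A :: "'a \<Rightarrow> 'b set"
  assumes "finite I" and "\<And>i. i \<in> I \<Longrightarrow> finite (A i)"
    and "\<And>J. J \<subseteq> I \<Longrightarrow> card J \<le> card (\<Union>i\<in>J. A i)"
  shows "\<exists>g. inj_on g I \<and> (\<forall>i\<in>I. g i \<in> A i)"
  using assms
proof (induction I arbitrary: A rule: finite_psubset_induct)
  case (psubset I)
  note fin = psubset.prems(1) and hall = psubset.prems(2)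
  have finU: "finite (\<Union>i\<in>J. A i)" if "J \<subseteq> I" for J
    using that psubset.hyps fin by (auto intro: finite_subset)
  show ?case
  proof (cases "\<exists>J. J \<subset> I \<and> J \<noteq> {} \<and> card (\<Union>i\<in>J. A i) = card J")
    case True
    then obtain J where J: "J \<subset> I" "J \<noteq> {}" "card (\<Union>i\<in>J. A i) = card J" by blast
    let ?U = "\<Union>i\<in>J. A i"
    have finJ: "finite J" using J psubset.hyps by (blast intro: finite_subset)
    have "\<exists>g. inj_on g J \<and> (\<forall>i\<in>J. g i \<in> A i)"
      using J fin hall by (intro psubset.IH) auto
    then obtain g where g: "inj_on g J" "\<forall>i\<in>J. g i \<in> A i" by blast
    have "\<exists>h. inj_on h (I - J) \<and> (\<forall>i\<in>I - J. h i \<in> A i - ?U)"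
    proof (rule psubset.IH)
      show "I - J \<subset> I" using J by blast
      show "finite (A i - ?U)" if "i \<in> I - J" for i using that fin by auto
      fix L assume L: "L \<subseteq> I - J"
      have finL: "finite L" using L psubset.hyps by (blast intro: finite_subset)
      have "card L + card J = card (L \<union> J)"
        using L finL finJ by (subst card_Un_disjoint) auto
      also have "\<dots> \<le> card (\<Union>i\<in>L \<union> J. A i)" using L J by (intro hall) auto
      also have "(\<Union>i\<in>L \<union> J. A i) = (\<Union>i\<in>L. A i - ?U) \<union> ?U" by auto
      also have "card \<dots> \<le> card (\<Union>i\<in>L. A i - ?U) + card ?U" by (rule card_Un_le)
      finally show "card L \<le> card (\<Union>i\<in>L. A i - ?U)" using J by simp
    qed
    then obtain h where h: "inj_on h (I - J)" "\<forall>i\<in>I - J. h i \<in> A i - ?U" by blast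
    have "inj_on (\<lambda>i. if i \<in> J then g i else h i) I"
      using g h unfolding inj_on_def by (metis DiffD2 DiffI UN_I)
    then show ?thesis
      using g h by (intro exI[of _ "\<lambda>i. if i \<in> J then g i else h i"]) auto
  next
    case no_tight: False
    show ?thesis
    proof (cases "I = {}")
      case False
      then obtain i where i: "i \<in> I" by blast
      have "A i \<noteq> {}" using hall[of "{i}"] i by auto
      then obtain x where x: "x \<in> A i" by blast
      have "\<exists>h. inj_on h (I - {i}) \<and> (\<forall>j\<in>I - {i}. h j \<in> A j - {x})"
      proof (rule psubset.IH)
        show "I - {i} \<subset> I" using i by blast
        show "finite (A j - {x})" if "j \<in> I - {i}" for j using that fin by auto
        fix L assume L: "L \<subseteq> I - {i}"
        show "card L \<le> card (\<Union>j\<in>L. A j - {x})"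
        proof (cases "L = {}")
          case False
          have "L \<subset> I" using L i by blast
          then have "card L < card (\<Union>j\<in>L. A j)"
            using hall[of L] no_tight False by (metis le_neq_implies_less psubset_imp_subset)
          also have "\<dots> \<le> card (insert x (\<Union>j\<in>L. A j - {x}))"
            using finU[of L] L by (intro card_mono) (auto intro: finite_subset)
          also have "\<dots> \<le> Suc (card (\<Union>j\<in>L. A j - {x}))" by (rule card_insert_le_m1[THEN order_trans]) auto
          finally show ?thesis by simp
        qed simp
      qed
      then obtain h where h: "inj_on h (I - {i})" "\<forall>j\<in>I - {i}. h j \<in> A j - {x}" by blast
      have "inj_on (h(i := x)) I"
        using h unfolding inj_on_def by (metis DiffD2 DiffI fun_upd_apply singletonD singletonI)
      moreover have "\<forall>j\<in>I. (h(i := x)) j \<in> A j"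
        using h(2) x by auto
      ultimately show ?thesis by blast
    qed simp
  qed
qed

section \<open>Decomposing left-regular graphs into matchings\<close>

text \<open>
  The bound on the right degrees makes these graphs exactly the unions of \<open>d\<close> disjoint
  left-saturating matchings, since each matching meets a right-node at most once.
\<close>

definition left_regular :: "nat \<Rightarrow> ('n::finite \<times> 'm::finite) set \<Rightarrow> bool" where
  "left_regular d Q \<longleftrightarrow> (\<forall>i. card (Q `` {i}) = d) \<and> (\<forall>j. card (Q\<inverse> `` {j}) \<le> d)"

lemma card_edges_by_left:
  fixes Q :: "('n::finite \<times> 'm::finite) set"
  shows "card (Q \<inter> X \<times> Y) = (\<Sum>i\<in>X. card (Q `` {i} \<inter> Y))"
proof -
  have "Q \<inter> X \<times> Y = Sigma X (\<lambda>i. Q `` {i} \<inter> Y)" by auto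
  then show ?thesis by (simp add: card_SigmaI)
qed

lemma card_edges_by_right:
  fixes Q :: "('n::finite \<times> 'm::finite) set"
  shows "card (Q \<inter> X \<times> Y) = (\<Sum>j\<in>Y. card (Q\<inverse> `` {j} \<inter> X))"
proof -
  have "card (Q \<inter> X \<times> Y) = card ((Q \<inter> X \<times> Y)\<inverse>)" by simp
  also have "(Q \<inter> X \<times> Y)\<inverse> = Q\<inverse> \<inter> Y \<times> X" by auto
  finally show ?thesis by (simp add: card_edges_by_left)
qed

lemma left_regular_card: "left_regular d Q \<Longrightarrow> card Q = CARD('n) * d"
  for Q :: "('n::finite \<times> 'm::finite) set"
  using card_edges_by_left[of Q UNIV UNIV] by (simp add: left_regular_def)

lemma left_regular_CARD_le:
  fixes Q :: "('n::finite \<times> 'm::finite) set"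
  assumes "left_regular d Q" and "0 < d"
  shows "CARD('n) \<le> CARD('m)"
proof -
  have "CARD('n) * d = (\<Sum>j\<in>UNIV. card (Q\<inverse> `` {j}))"
    using left_regular_card[OF assms(1)] card_edges_by_right[of Q UNIV UNIV] by simp
  also have "\<dots> \<le> (\<Sum>j\<in>(UNIV :: 'm set). d)"
    using assms(1) unfolding left_regular_def by (intro sum_mono) blast
  finally show ?thesis using assms(2) by simp
qed

text \<open>
  The matching has to meet all right-nodes of degree \<open>d\<close>, so that its removal lowers the degree
  bound on the right as well. To force this, add \<open>m - n\<close> dummy left-nodes that may only be matched
  to right-nodes of degree less than \<open>d\<close>. A system of distinct representatives of the enlarged
  family is a bijection onto the right-nodes, so those of degree \<open>d\<close> get a genuine partner.
  Hall's condition comes from counting edges: for genuine left-nodes \<open>X\<close> alone, between \<open>X\<close> and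
  its neighbours; when dummy nodes are present, between the non-neighbours \<open>Z\<close>, which all have
  degree \<open>d\<close>, and the complement of \<open>X\<close>.
\<close>

lemma left_regular_matching:
  fixes Q :: "('n::finite \<times> 'm::finite) set"
  assumes Q: "left_regular d Q" and "0 < d"
  obtains f where "inj f" "\<And>i. (i, f i) \<in> Q"
    "\<And>j. card (Q\<inverse> `` {j}) = d \<Longrightarrow> j \<in> range f"
proof -
  have degl: "card (Q `` {i}) = d" and degr: "card (Q\<inverse> `` {j}) \<le> d" for i j
    using Q by (auto simp: left_regular_def)
  note le = left_regular_CARD_le[OF assms]
  define S where "S = {j. card (Q\<inverse> `` {j}) < d}"
  obtain D :: "'m set" where D: "card D = CARD('m) - CARD('n)"
    using obtain_subset_with_card_n[of "CARD('m) - CARD('n)" "UNIV :: 'm set"] by auto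
  define I where "I = Inl ` (UNIV :: 'n set) \<union> Inr ` D"
  define A :: "'n + 'm \<Rightarrow> 'm set" where "A = case_sum (\<lambda>i. Q `` {i}) (\<lambda>_. S)"
  have "\<exists>g. inj_on g I \<and> (\<forall>i\<in>I. g i \<in> A i)"
  proof (rule hall_system_of_distinct_representatives)
    fix J assume J: "J \<subseteq> I"
    define X where "X = {i. Inl i \<in> J}"
    define Y where "Y = {y. Inr y \<in> J}"
    have JXY: "J = Inl ` X \<union> Inr ` Y"
      unfolding X_def Y_def by (auto simp: image_iff) (metis sum.exhaust)
    have cJ: "card J = card X + card Y"
      unfolding JXY by (subst card_Un_disjoint) (auto simp: card_image)
    have U: "(\<Union>x\<in>J. A x) = Q `` X \<union> (if Y = {} then {} else S)"
      unfolding JXY A_def by auto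
    show "card J \<le> card (\<Union>x\<in>J. A x)"
    proof (cases "Y = {}")
      case True
      have "card X * d = card (Q \<inter> X \<times> (Q `` X))"
      proof -
        have "Q `` {i} \<inter> Q `` X = Q `` {i}" if "i \<in> X" for i using that by auto
        then show ?thesis by (simp add: card_edges_by_left degl)
      qed
      also have "\<dots> \<le> (\<Sum>j\<in>Q `` X. d)"
        unfolding card_edges_by_right
        by (intro sum_mono order_trans[OF card_mono degr]) auto
      finally show ?thesis using True \<open>0 < d\<close> U cJ by simp
    next
      case False
      define Z where "Z = - (\<Union>x\<in>J. A x)"
      have Z: "Z \<inter> Q `` X = {}" "\<And>j. j \<in> Z \<Longrightarrow> card (Q\<inverse> `` {j}) = d"
        using degr False unfolding Z_def U S_def by (auto intro: le_antisym)
      have "card Z * d = card (Q \<inter> (- X) \<times> Z)"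
      proof -
        have "Q\<inverse> `` {j} \<inter> - X = Q\<inverse> `` {j}" if "j \<in> Z" for j using that Z(1) by auto
        then show ?thesis by (simp add: card_edges_by_right Z(2))
      qed
      also have "\<dots> \<le> (\<Sum>i\<in>- X. d)"
        unfolding card_edges_by_left
        by (intro sum_mono order_trans[OF card_mono eq_refl[OF degl]]) auto
      finally have "card Z \<le> card (- X)" using \<open>0 < d\<close> by simp
      then have "card Z + card X \<le> CARD('n)"
        using card_mono[of UNIV X] by (simp add: card_Diff_subset Compl_eq_Diff_UNIV)
      moreover have "card (\<Union>x\<in>J. A x) + card Z = CARD('m)"
        unfolding Z_def by (simp add: card_Diff_subset Compl_eq_Diff_UNIV card_mono)
      moreover have "card Y \<le> card D"
        using J by (intro card_mono) (auto simp: Y_def I_def)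
      ultimately show ?thesis using le cJ D by linarith
    qed
  qed (auto simp: I_def)
  then obtain g where g: "inj_on g I" "\<And>x. x \<in> I \<Longrightarrow> g x \<in> A x" by blast
  have "card I = CARD('n) + card D"
    unfolding I_def by (subst card_Un_disjoint) (auto simp: card_image)
  then have "card (g ` I) = CARD('m)"
    using g(1) D le by (simp add: card_image)
  then have surj: "g ` I = UNIV" by (intro card_subset_eq) auto
  show thesis
  proof (rule that)
    show "inj (g \<circ> Inl)"
      using g(1) by (auto simp: inj_on_def I_def)
    show "(i, (g \<circ> Inl) i) \<in> Q" for i
      using g(2)[of "Inl i"] by (auto simp: I_def A_def)
    show "j \<in> range (g \<circ> Inl)" if tight: "card (Q\<inverse> `` {j}) = d" for j
    proof -
      obtain x where x: "x \<in> I" "j = g x" using surj by blast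
      then have "x \<notin> range Inr"
        using g(2)[of x] tight by (auto simp: A_def S_def)
      then show ?thesis using x by (auto simp: I_def)
    qed
  qed
qed

text \<open>
  Pairwise disjoint left-saturating matchings \<open>f c\<close>, one for each colour \<open>c\<close> in \<open>C\<close>; injectivity
  in \<open>c\<close> is their disjointness.
\<close>

definition matching_packing ::
    "nat set \<Rightarrow> (nat \<Rightarrow> 'n::finite \<Rightarrow> 'm::finite) \<Rightarrow> ('n \<times> 'm) set \<Rightarrow> bool" where
  "matching_packing C f E \<longleftrightarrow> (\<forall>c\<in>C. inj (f c)) \<and> (\<forall>i. inj_on (\<lambda>c. f c i) C) \<and>
     (\<forall>c\<in>C. \<forall>i. (i, f c i) \<in> E)"

lemma matching_packing_mono:
  "matching_packing C f E \<Longrightarrow> C' \<subseteq> C \<Longrightarrow> E \<subseteq> E' \<Longrightarrow> matching_packing C' f E'"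
  unfolding matching_packing_def by (blast intro: inj_on_subset)

definition packing_edges :: "nat set \<Rightarrow> (nat \<Rightarrow> 'n \<Rightarrow> 'm) \<Rightarrow> ('n \<times> 'm) set" where
  "packing_edges C f = (\<Union>c\<in>C. range (\<lambda>i. (i, f c i)))"

lemma packing_edges_subset: "matching_packing C f E \<Longrightarrow> packing_edges C f \<subseteq> E"
  by (auto simp: packing_edges_def matching_packing_def)

lemma left_regular_packing_edges:
  fixes f :: "nat \<Rightarrow> 'n::finite \<Rightarrow> 'm::finite"
  assumes f: "matching_packing C f E" and "finite C"
  shows "left_regular (card C) (packing_edges C f)"
  unfolding left_regular_def
proof safe
  fix i
  have "packing_edges C f `` {i} = (\<lambda>c. f c i) ` C"
    by (auto simp: packing_edges_def)
  then show "card (packing_edges C f `` {i}) = card C"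
    using f by (simp add: card_image matching_packing_def)
next
  fix j
  have "(packing_edges C f)\<inverse> `` {j} \<subseteq> (\<lambda>c. inv (f c) j) ` C"
    using f by (force simp: packing_edges_def matching_packing_def)
  then show "card ((packing_edges C f)\<inverse> `` {j}) \<le> card C"
    using \<open>finite C\<close> surj_card_le by blast
qed

lemma left_regular_decompose:
  fixes Q :: "('n::finite \<times> 'm::finite) set"
  assumes "left_regular d Q"
  shows "\<exists>f. matching_packing {..<d} f Q"
  using assms
proof (induction d arbitrary: Q)
  case 0
  then show ?case by (simp add: matching_packing_def)
next
  case (Suc d)
  obtain g where g: "inj g" "\<And>i. (i, g i) \<in> Q"
      "\<And>j. card (Q\<inverse> `` {j}) = Suc d \<Longrightarrow> j \<in> range g"
    using left_regular_matching[OF Suc.prems] by blast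
  define R where "R = Q - range (\<lambda>i. (i, g i))"
  have "left_regular d R"
    unfolding left_regular_def
  proof safe
    fix i
    have "R `` {i} = Q `` {i} - {g i}" by (auto simp: R_def)
    then show "card (R `` {i}) = d"
      using g(2)[of i] Suc.prems by (simp add: left_regular_def)
  next
    fix j
    show "card (R\<inverse> `` {j}) \<le> d"
    proof (cases "j \<in> range g")
      case True
      then obtain i where i: "j = g i" by blast
      then have "R\<inverse> `` {j} = Q\<inverse> `` {j} - {i}"
        using g(1) by (auto simp: R_def inj_def)
      then show ?thesis
        using g(2)[of i] i Suc.prems by (simp add: left_regular_def le_diff_conv)
    next
      case False
      then have "card (Q\<inverse> `` {j}) \<le> d"
        using g(3)[of j] Suc.prems by (auto simp: left_regular_def le_Suc_eq)
      then show ?thesis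
        by (rule order_trans[rotated]) (auto simp: R_def intro!: card_mono)
    qed
  qed
  then obtain f where f: "matching_packing {..<d} f R"
    using Suc.IH by blast
  have "f c i \<noteq> g i" if "c < d" for c i
    using f that unfolding matching_packing_def R_def by (metis DiffD2 lessThan_iff rangeI)
  then have "inj_on (\<lambda>c. (f(d := g)) c i) {..<Suc d}" for i
    using f unfolding matching_packing_def inj_on_def lessThan_Suc
    by (metis fun_upd_apply insert_iff lessThan_iff)
  then have "matching_packing {..<Suc d} (f(d := g)) Q"
    using f g(1,2) by (auto simp: matching_packing_def R_def lessThan_Suc)
  then show ?case by blast
qed


lemma left_regular_subgraph_iff_packing:
  "(\<exists>Q\<subseteq>E. left_regular d Q) \<longleftrightarrow> (\<exists>f. matching_packing {..<d} f E)"
  for E :: "('n::finite \<times> 'm::finite) set"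
proof
  assume "\<exists>Q\<subseteq>E. left_regular d Q"
  then show "\<exists>f. matching_packing {..<d} f E"
    using left_regular_decompose matching_packing_mono by blast
next
  assume "\<exists>f. matching_packing {..<d} f E"
  then obtain f where "matching_packing {..<d} f E" by blast
  then show "\<exists>Q\<subseteq>E. left_regular d Q"
    using left_regular_packing_edges[of "{..<d}" f E] packing_edges_subset[of "{..<d}" f E]
    by auto
qed

lemma left_regular_subgraph_mono:
  fixes Q :: "('n::finite \<times> 'm::finite) set"
  assumes "left_regular d Q" and "d' \<le> d"
  shows "\<exists>R\<subseteq>Q. left_regular d' R"
  using assms left_regular_decompose[of d Q] matching_packing_mono[of "{..<d}" _ Q "{..<d'}" Q]
  unfolding left_regular_subgraph_iff_packing by auto

text \<open>
  The complete graph is left-\<open>m\<close>-regular, as its right degrees are \<open>n \<le> m\<close>; take the union of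
  \<open>d\<close> of the \<open>m\<close> matchings into which it decomposes.
\<close>

lemma left_regular_exists:
  assumes "CARD('n) \<le> CARD('m)" and "d \<le> CARD('m)"
  shows "\<exists>Q :: ('n::finite \<times> 'm::finite) set. left_regular d Q"
proof -
  have "left_regular CARD('m) (UNIV :: ('n \<times> 'm) set)"
    using assms(1) by (simp add: left_regular_def Image_def)
  then show ?thesis
    using left_regular_subgraph_mono assms(2) by blast
qed

section \<open>Rank and resilience of the pattern of a graph\<close>

lemma mem_graph_pattern:
  fixes A :: "real^'m::finite^'n::finite"
  shows "A \<in> graph_pattern E \<longleftrightarrow> (\<forall>i j. A $ i $ j \<noteq> 0 \<longrightarrow> (i, j) \<in> E)"
proof
  assume A: "A \<in> graph_pattern E"
  let ?S = "{A :: real^'m^'n. \<forall>i j. A $ i $ j \<noteq> 0 \<longrightarrow> (i, j) \<in> E}"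
  have "subspace ?S"
    unfolding subspace_def by (auto, metis add_0)
  moreover have "unit_matrix ` E \<subseteq> ?S" by (auto simp: unit_matrix_nth split: if_splits)
  ultimately show "\<forall>i j. A $ i $ j \<noteq> 0 \<longrightarrow> (i, j) \<in> E"
    using A span_minimal unfolding graph_pattern_def by blast
next
  assume A: "\<forall>i j. A $ i $ j \<noteq> 0 \<longrightarrow> (i, j) \<in> E"
  have entry: "unit_matrix e $ r $ c = (if e = (r, c) then 1 else 0)" for e :: "'n \<times> 'm" and r c
    by (cases e) (auto simp: unit_matrix_nth)
  have "A = (\<Sum>e\<in>UNIV. (A $ fst e $ snd e) *\<^sub>R unit_matrix e)"
    by (simp add: vec_eq_iff entry if_distrib cong: if_cong)
  also have "\<dots> \<in> graph_pattern E"
    unfolding graph_pattern_def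
  proof (intro span_sum)
    fix e :: "'n \<times> 'm"
    have "A $ fst e $ snd e = 0 \<or> unit_matrix e \<in> unit_matrix ` E"
      using A by (metis imageI prod.collapse)
    then show "(A $ fst e $ snd e) *\<^sub>R unit_matrix e \<in> span (unit_matrix ` E)"
      by (metis scaleR_zero_left span_base span_scale span_zero)
  qed
  finally show "A \<in> graph_pattern E" .
qed

lemma sparsity_pattern_graph_pattern: "sparsity_pattern (graph_pattern E)"
  for E :: "('n::finite \<times> 'm::finite) set"
proof -
  have "unit_matrix e \<in> Basis" for e :: "'n \<times> 'm"
    by (simp add: unit_matrix_def)
  then have "independent (unit_matrix ` E)"
    by (intro independent_mono[OF independent_Basis]) auto
  then show ?thesis
    unfolding sparsity_pattern_def graph_pattern_def
    by (intro conjI subspace_span exI[of _ "unit_matrix ` E"]) auto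
qed

lemma sparsity_pattern_eq_graph_pattern:
  assumes "sparsity_pattern S"
  shows "S = graph_pattern (index_set S)"
proof -
  obtain B where B: "subspace S" "B \<subseteq> range unit_matrix" "span B = S"
    using assms unfolding sparsity_pattern_def by blast
  have "B \<subseteq> S" using B(3) span_superset by blast
  then have "B \<subseteq> unit_matrix ` index_set S"
    using B(2) unfolding index_set_def by blast
  moreover have "unit_matrix ` index_set S \<subseteq> S" by (auto simp: index_set_def)
  ultimately show ?thesis
    unfolding graph_pattern_def using B(1,3) span_mono[of B "unit_matrix ` index_set S"]
      span_minimal[of "unit_matrix ` index_set S" S] by blast
qed

text \<open>
  Multilinearity of the determinant in the rows, with an index type for the sums that is
  independent of the dimension.
\<close>

lemma det_sum_rows:
  fixes a :: "'n::finite \<Rightarrow> 'm::finite \<Rightarrow> 'a::comm_ring_1^'n"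
  shows "det (\<chi> i. \<Sum>j\<in>UNIV. a i j) = (\<Sum>f\<in>UNIV. det (\<chi> i. a i (f i)))"
proof -
  have "(\<Prod>i\<in>UNIV. \<Sum>j\<in>UNIV. a i j $ p i) = (\<Sum>f\<in>UNIV. \<Prod>i\<in>UNIV. a i (f i) $ p i)"
    for p :: "'n \<Rightarrow> 'n"
    by (subst prod_sum_PiE) auto
  then show ?thesis
    unfolding det_def by (simp add: sum_distrib_left) (rule sum.swap)
qed

text \<open>
  Expand \<open>det (A ** B) = 1\<close>, where \<open>B\<close> is a right inverse of \<open>A\<close>, over all ways \<open>f\<close> to pick one row of
  \<open>B\<close> for each row of \<open>A\<close>. Picks with a repetition contribute \<open>0\<close>, so some injective \<open>f\<close>
  contributes a nonzero term, which has the entries \<open>A $ i $ f i\<close> as factors.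
\<close>

lemma full_row_rank_transversal:
  fixes A :: "real^'m::finite^'n::finite"
  assumes "rank A = CARD('n)"
  shows "\<exists>f. inj f \<and> (\<forall>i. A $ i $ f i \<noteq> 0)"
proof -
  obtain B :: "real^'n^'m" where "A ** B = mat 1"
    using assms by (auto simp: full_rank_surjective matrix_right_invertible_surjective[symmetric])
  then have "1 = det (A ** B)" by simp
  also have "\<dots> = (\<Sum>f\<in>UNIV. det (\<chi> i. A $ i $ f i *s B $ f i))"
  proof -
    have "A ** B = (\<chi> i. \<Sum>j\<in>UNIV. A $ i $ j *s B $ j)"
      by (simp add: matrix_matrix_mult_def vec_eq_iff)
    then show ?thesis by (simp only: det_sum_rows)
  qed
  also have "\<dots> = (\<Sum>f\<in>UNIV. (\<Prod>i\<in>UNIV. A $ i $ f i) * det (\<chi> i. B $ f i))"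
    by (simp add: det_rows_mul)
  finally have "(\<Sum>f\<in>UNIV. (\<Prod>i\<in>UNIV. A $ i $ f i) * det (\<chi> i. B $ f i)) \<noteq> 0"
    by simp
  then obtain f where f: "(\<Prod>i\<in>UNIV. A $ i $ f i) * det (\<chi> i. B $ f i) \<noteq> 0"
    by (rule sum.not_neutral_contains_not_neutral)
  have "inj f"
  proof (rule injI, rule ccontr)
    fix i j assume "f i = f j" "i \<noteq> j"
    then have "det (\<chi> i. B $ f i) = 0"
      by (intro det_identical_rows[of i j]) (auto simp: row_def)
    then show False using f by simp
  qed
  then show ?thesis using f by auto
qed

lemma matching_matrix_full_row_rank:
  fixes f :: "'n::finite \<Rightarrow> 'm::finite"
  assumes "inj f"
  shows "rank ((\<chi> i j. if j = f i then 1 else 0) :: real^'m^'n) = CARD('n)"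
proof -
  let ?A = "(\<chi> i j. if j = f i then 1 else 0) :: real^'m^'n"
  have "(\<Sum>j\<in>UNIV. (if j = f r then 1 else 0) * (if j = f c then 1 else 0)) =
      (if r = c then 1 else 0 :: real)" for r c
  proof -
    have "(\<Sum>j\<in>UNIV. (if j = f r then 1 else 0) * (if j = f c then 1 else 0 :: real)) =
        (\<Sum>j\<in>UNIV. if j = f r then (if f r = f c then 1 else 0) else 0)"
      by (intro sum.cong) auto
    also have "\<dots> = (if r = c then 1 else 0)"
      using assms by (simp add: inj_eq)
    finally show ?thesis .
  qed
  then have "?A ** transpose ?A = mat 1"
    by (simp add: vec_eq_iff matrix_matrix_mult_def transpose_def mat_def)
  then have "CARD('n) \<le> rank ?A"
    using rank_mul_le_left[of ?A "transpose ?A"] by (simp add: rank_I)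
  then show ?thesis using rank_bound[of ?A] by simp
qed

lemma finite_rank_image: "finite (rank ` (S :: (real^'m::finite^'n::finite) set))"
  by (rule finite_subset[of _ "{..CARD('n)}"]) (use rank_bound in fastforce)+

lemma pattern_rank_graph_pattern_le:
  "pattern_rank (graph_pattern E :: (real^'m^'n) set) \<le> CARD('n)"
  for E :: "('n::finite \<times> 'm::finite) set"
proof -
  have "0 \<in> (graph_pattern E :: (real^'m^'n) set)" by (simp add: mem_graph_pattern)
  then show ?thesis
    unfolding pattern_rank_def using finite_rank_image rank_bound
    by (subst Max_le_iff) (auto simp: min_le_iff_disj)
qed

lemma pattern_rank_full_iff:
  fixes E :: "('n::finite \<times> 'm::finite) set"
  shows "pattern_rank (graph_pattern E) = CARD('n) \<longleftrightarrow> (\<exists>f. inj f \<and> (\<forall>i. (i, f i) \<in> E))"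
proof
  assume r: "pattern_rank (graph_pattern E) = CARD('n)"
  have "0 \<in> graph_pattern E" by (simp add: mem_graph_pattern)
  then have "pattern_rank (graph_pattern E) \<in> rank ` graph_pattern E"
    unfolding pattern_rank_def using finite_rank_image by (intro Max_in) auto
  then obtain A where "A \<in> graph_pattern E" "rank A = CARD('n)"
    using r by auto
  then show "\<exists>f. inj f \<and> (\<forall>i. (i, f i) \<in> E)"
    using full_row_rank_transversal[of A] unfolding mem_graph_pattern by blast
next
  assume "\<exists>f. inj f \<and> (\<forall>i. (i, f i) \<in> E)"
  then obtain f where f: "inj f" "\<And>i. (i, f i) \<in> E" by blast
  let ?A = "(\<chi> i j. if j = f i then 1 else 0) :: real^'m^'n"
  have "?A \<in> graph_pattern E" using f(2) by (simp add: mem_graph_pattern)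
  then have "CARD('n) \<le> pattern_rank (graph_pattern E)"
    unfolding pattern_rank_def matching_matrix_full_row_rank[OF f(1), symmetric]
    using finite_rank_image by (intro Max_ge) auto
  then show "pattern_rank (graph_pattern E) = CARD('n)"
    using pattern_rank_graph_pattern_le[of E] by simp
qed

text \<open>Without one of its edges, the matching leaves a left-node isolated.\<close>

lemma zero_resilient_matching:
  fixes f :: "'n::finite \<Rightarrow> 'm::finite"
  assumes "inj f"
  shows "zero_resilient (graph_pattern (range (\<lambda>i. (i, f i))))"
proof -
  let ?M = "range (\<lambda>i. (i, f i))"
  obtain i :: 'n where True by blast
  let ?M' = "?M - {(i, f i)}"
  have "pattern_rank (graph_pattern ?M) = CARD('n)"
    using assms by (auto simp: pattern_rank_full_iff)
  moreover have "pattern_rank (graph_pattern ?M') < CARD('n)"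
  proof -
    have "(i, j) \<notin> ?M'" for j by auto
    then have "pattern_rank (graph_pattern ?M') \<noteq> CARD('n)"
      unfolding pattern_rank_full_iff by blast
    then show ?thesis
      using pattern_rank_graph_pattern_le[of ?M'] by linarith
  qed
  moreover have "card ?M' + 1 = card ?M"
    using card_Suc_Diff1[of ?M "(i, f i)"] by simp
  ultimately show ?thesis
    unfolding zero_resilient_def
    by (intro conjI sparsity_pattern_graph_pattern exI[of _ "graph_pattern ?M'"])
      (simp_all add: index_set_graph_pattern Diff_subset)
qed

text \<open>
  A 0-resilient pattern has full rank and thus contains a left-saturating matching, whose own
  pattern is 0-resilient: it suffices to consider direct sums of patterns of matchings.
\<close>

lemma contains_direct_sum_iff:
  fixes E :: "('n::finite \<times> 'm::finite) set"
  shows "contains_direct_sum q (graph_pattern E) \<longleftrightarrow> (\<exists>Q\<subseteq>E. left_regular q Q)"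
  unfolding left_regular_subgraph_iff_packing
proof
  assume "contains_direct_sum q (graph_pattern E)"
  then obtain T :: "nat \<Rightarrow> (real^'m^'n) set"
    where T: "\<And>c. c < q \<Longrightarrow> zero_resilient (T c)"
      and disj: "disjoint_family_on (\<lambda>c. index_set (T c)) {..<q}"
      and sub: "span (\<Union>c<q. T c) \<subseteq> graph_pattern E"
    unfolding contains_direct_sum_def by blast
  have "\<exists>g. inj g \<and> (\<forall>i. (i, g i) \<in> index_set (T c))" if "c < q" for c
    using T[OF that] sparsity_pattern_eq_graph_pattern[of "T c"]
      pattern_rank_full_iff[of "index_set (T c)"]
    unfolding zero_resilient_def by metis
  then obtain f where f: "\<And>c. c < q \<Longrightarrow> inj (f c)"
      "\<And>c i. c < q \<Longrightarrow> (i, f c i) \<in> index_set (T c)"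
    by metis
  have "index_set (T c) \<subseteq> E" if "c < q" for c
  proof -
    have "T c \<subseteq> span (\<Union>c<q. T c)" using that by (auto intro: span_base)
    then have "index_set (T c) \<subseteq> index_set (graph_pattern E)"
      using sub unfolding index_set_def by blast
    then show ?thesis by (simp add: index_set_graph_pattern)
  qed
  moreover have "inj_on (\<lambda>c. f c i) {..<q}" for i
    using disj f(2) unfolding disjoint_family_on_def inj_on_def
    by (metis disjoint_iff lessThan_iff)
  ultimately show "\<exists>f. matching_packing {..<q} f E"
    using f unfolding matching_packing_def by blast
next
  assume "\<exists>f. matching_packing {..<q} f E"
  then obtain f where f: "matching_packing {..<q} f E" by blast
  define T where "T c = graph_pattern (range (\<lambda>i. (i, f c i)))" for c
  have "T c \<subseteq> graph_pattern E" if "c < q" for c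
    unfolding T_def graph_pattern_def
    using f that by (intro span_mono image_mono) (auto simp: matching_packing_def)
  then have "span (\<Union>c<q. T c) \<subseteq> graph_pattern E"
    by (intro span_minimal) (auto simp: graph_pattern_def)
  moreover have "\<forall>c<q. zero_resilient (T c)"
    using f unfolding T_def matching_packing_def by (auto intro: zero_resilient_matching)
  moreover have "disjoint_family_on (\<lambda>c. index_set (T c)) {..<q}"
    using f by (auto simp: T_def index_set_graph_pattern disjoint_family_on_def
        matching_packing_def inj_on_def)
  ultimately show "contains_direct_sum q (graph_pattern E)"
    unfolding contains_direct_sum_def by blast
qed

lemma strongly_resilient_iff:
  fixes E :: "('n::finite \<times> 'm::finite) set"
  shows "strongly_resilient k (graph_pattern E) \<longleftrightarrow>
    (\<exists>Q\<subseteq>E. left_regular (k + 1) Q) \<and> \<not> (\<exists>Q\<subseteq>E. left_regular (k + 2) Q)"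
proof -
  have "pattern_rank (graph_pattern E) = CARD('n)" if "\<exists>Q\<subseteq>E. left_regular (k + 1) Q"
    using that unfolding left_regular_subgraph_iff_packing pattern_rank_full_iff
    by (auto simp: matching_packing_def)
  then show ?thesis
    unfolding strongly_resilient_def contains_direct_sum_iff
    using sparsity_pattern_graph_pattern by blast
qed

lemma left_regular_degree_le:
  fixes Q :: "('n::finite \<times> 'm::finite) set"
  assumes "left_regular d Q"
  shows "d \<le> CARD('m)"
  using assms card_mono[of UNIV "Q `` {undefined}"] by (simp add: left_regular_def)

text \<open>
  The degree is defined by a definite description, so its value is only known once some strong
  resilience index exists: take the largest \<open>d\<close> with a left-\<open>d\<close>-regular subgraph.
\<close>

lemma strong_resilience_degree_ge:
  fixes E :: "('n::finite \<times> 'm::finite) set"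
  assumes "Q \<subseteq> E" and "left_regular (k + 1) Q"
  shows "int k \<le> strong_resilience_degree (graph_pattern E)"
proof -
  let ?P = "\<lambda>d. \<exists>Q\<subseteq>E. left_regular d Q"
  have P: "?P (k + 1)" and bound: "\<And>d. ?P d \<Longrightarrow> d \<le> CARD('m)"
    using assms left_regular_degree_le by blast+
  define d where "d = Greatest ?P"
  have d: "?P d" "k + 1 \<le> d" "\<not> ?P (Suc d)"
    unfolding d_def
    using GreatestI_nat[of ?P, OF P bound] Greatest_le_nat[of ?P, OF P bound]
      Greatest_le_nat[of ?P "Suc (Greatest ?P)", OF _ bound] by (blast, blast, fastforce)
  then have "strongly_resilient (d - 1) (graph_pattern E)"
    unfolding strongly_resilient_iff by (cases d) auto
  then show ?thesis using d(2) by (simp add: strong_resilience_degree_eq)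
qed

section \<open>Maximum \<open>b\<close>-matchings\<close>

lemma b_matching_iff:
  fixes Q :: "('n::finite \<times> 'm::finite) set"
  shows "b_matching k Q \<longleftrightarrow>
    (\<forall>i. card (Q `` {i}) \<le> k + 1) \<and> (\<forall>j. card (Q\<inverse> `` {j}) \<le> k + 1)"
proof -
  have "{e \<in> Q. incident (Inl i) e} = Pair i ` (Q `` {i})" for i
    by (auto simp: incident_def)
  moreover have "{e \<in> Q. incident (Inr j) e} = (\<lambda>i. (i, j)) ` (Q\<inverse> `` {j})" for j
    by (auto simp: incident_def)
  ultimately show ?thesis
    unfolding b_matching_def complete_edges_def
    by (simp add: split_sum_all card_image inj_on_def)
qed

text \<open>
  The left degrees add up to \<open>card Q\<close>, so the size \<open>n (k + 1)\<close> forces each of them to its bound.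
\<close>

lemma left_regular_iff_b_matching:
  fixes Q :: "('n::finite \<times> 'm::finite) set"
  shows "left_regular (k + 1) Q \<longleftrightarrow> b_matching k Q \<and> card Q = CARD('n) * (k + 1)"
proof
  assume "b_matching k Q \<and> card Q = CARD('n) * (k + 1)"
  then have b: "\<And>i. card (Q `` {i}) \<le> k + 1" "\<And>j. card (Q\<inverse> `` {j}) \<le> k + 1"
    and "(\<Sum>i\<in>UNIV. card (Q `` {i})) = (\<Sum>i\<in>(UNIV :: 'n set). k + 1)"
    using card_edges_by_left[of Q UNIV UNIV] by (auto simp: b_matching_iff)
  then have "card (Q `` {i}) = k + 1" for i
    by (intro sum_mono_inv[of "\<lambda>i. card (Q `` {i})" UNIV "\<lambda>_. k + 1"]) auto
  then show "left_regular (k + 1) Q" using b by (simp add: left_regular_def)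
next
  assume Q: "left_regular (k + 1) Q"
  then show "b_matching k Q \<and> card Q = CARD('n) * (k + 1)"
    using left_regular_card[OF Q] by (simp add: left_regular_def b_matching_iff)
qed

lemma b_matching_card_le:
  fixes Q :: "('n::finite \<times> 'm::finite) set"
  assumes "b_matching k Q"
  shows "card Q \<le> CARD('n) * (k + 1)"
proof -
  have "card Q = (\<Sum>i\<in>UNIV. card (Q `` {i}))"
    using card_edges_by_left[of Q UNIV UNIV] by simp
  also have "\<dots> \<le> (\<Sum>i\<in>(UNIV :: 'n set). k + 1)"
    using assms unfolding b_matching_iff by (intro sum_mono) blast
  finally show ?thesis by simp
qed

lemma maximum_b_matching_iff:
  fixes Q :: "('n::finite \<times> 'm::finite) set"
  assumes "CARD('n) \<le> CARD('m)" and "k + 1 \<le> CARD('m)"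
  shows "maximum_b_matching k Q \<longleftrightarrow> left_regular (k + 1) Q"
proof -
  obtain R :: "('n \<times> 'm) set" where "left_regular (k + 1) R"
    using left_regular_exists[OF assms] by blast
  then show ?thesis
    unfolding maximum_b_matching_def is_arg_max_def left_regular_iff_b_matching
    using b_matching_card_le by (metis le_neq_implies_less leD)
qed

section \<open>Optimal edge addition\<close>

theorem theorem8:
  fixes E P :: "('n::finite \<times> 'm::finite) set" and k :: nat
  assumes "CARD('n) \<le> CARD('m)"
    and "k \<le> CARD('m) - 1"
    and "strong_resilience_degree (graph_pattern E) < int k"
    and "fair_b_matching k E P"
  shows "strongly_resilient k (graph_pattern (E \<union> P)) \<and>
    (\<exists>F \<subseteq> complement_edges E. strongly_resilient k (graph_pattern (E \<union> F)) \<and>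
        card F = card P - card (P \<inter> E)) \<and>
    (\<forall>F \<subseteq> complement_edges E. strongly_resilient k (graph_pattern (E \<union> F)) \<longrightarrow>
        card P - card (P \<inter> E) \<le> card F)"
proof -
  have "k + 1 \<le> CARD('m)"
    using assms(2) zero_less_card_finite[where 'a='m] by linarith
  note max_iff = maximum_b_matching_iff[OF assms(1) this]
  have P: "left_regular (k + 1) P"
    and fair: "\<And>Q. left_regular (k + 1) Q \<Longrightarrow> card (Q \<inter> E) \<le> card (P \<inter> E)"
    using assms(4) by (auto simp: fair_b_matching_def is_arg_max_def max_iff not_less)
  have new: "card Q - card (Q \<inter> E) = card (Q - E)" for Q :: "('n \<times> 'm) set"
    by (simp add: card_Diff_subset_Int)
  have fewest: "card (P - E) \<le> card (Q - E)" if "left_regular (k + 1) Q" for Q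
    using fair[OF that] left_regular_card[OF that] left_regular_card[OF P]
    unfolding new[symmetric] by linarith
  have not_in_E: "\<not> left_regular (k + 1) Q" if "Q \<subseteq> E" for Q
    using strong_resilience_degree_ge[OF that] assms(3) by force
  have "\<not> left_regular (k + 2) Q" if QEP: "Q \<subseteq> E \<union> P" for Q
  proof
    assume "left_regular (k + 2) Q"
    then obtain f where f: "matching_packing {..<k + 2} f Q"
      using left_regular_decompose by blast
    \<comment> \<open>\<open>R c\<close> competes with \<open>P\<close>: it is what remains when the matching of colour \<open>c\<close> is deleted.\<close>
    define R where "R c = packing_edges ({..<k + 2} - {c}) f" for c
    have RE: "R c - E = P - E" if "c < k + 2" for c
    proof (rule card_subset_eq)
      have pack: "matching_packing ({..<k + 2} - {c}) f Q"
        using f by (rule matching_packing_mono) auto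
      show "R c - E \<subseteq> P - E"
        using packing_edges_subset[OF pack] QEP unfolding R_def by blast
      have "left_regular (k + 1) (R c)"
        using left_regular_packing_edges[OF pack] that unfolding R_def by simp
      then have "card (P - E) \<le> card (R c - E)" by (rule fewest)
      then show "card (R c - E) = card (P - E)"
        using card_mono[OF _ \<open>R c - E \<subseteq> P - E\<close>] by simp
    qed simp
    have "\<not> P \<subseteq> E" using not_in_E P by blast
    then obtain i j where ij: "(i, j) \<in> P - E" by (auto simp: subset_iff)
    \<comment> \<open>Deleting some matching, say that of colour \<open>0\<close>, reveals the colour \<open>c\<close> of this edge; but
      it also survives the deletion of colour \<open>c\<close> and so has two colours.\<close>
    then have "(i, j) \<in> R 0" using RE[of 0] by auto
    then obtain c where c: "c < k + 2" "j = f c i"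
      by (auto simp: R_def packing_edges_def)
    have "(i, j) \<in> R c" using RE[OF c(1)] ij by auto
    then obtain c' where c': "c' < k + 2" "c' \<noteq> c" "j = f c' i"
      by (auto simp: R_def packing_edges_def)
    have inj: "inj_on (\<lambda>c. f c i) {..<k + 2}"
      using f unfolding matching_packing_def by blast
    have "f c i = f c' i" using c(2) c'(3) by (rule subst)
    then have "c = c'" using inj_onD[OF inj, of c c'] c(1) c'(1) by simp
    then show False using c'(2) by simp
  qed
  then have res: "strongly_resilient k (graph_pattern (E \<union> P))"
    using P unfolding strongly_resilient_iff by blast
  have added: "\<exists>F \<subseteq> complement_edges E. strongly_resilient k (graph_pattern (E \<union> F)) \<and>
      card F = card P - card (P \<inter> E)"
    using res by (intro exI[of _ "P - E"])
      (auto simp: complement_edges_def complete_edges_def new)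
  have fewest_added: "card P - card (P \<inter> E) \<le> card F"
    if "strongly_resilient k (graph_pattern (E \<union> F))" for F
  proof -
    have "\<exists>Q\<subseteq>E \<union> F. left_regular (k + 1) Q"
      using that unfolding strongly_resilient_iff by (rule conjunct1)
    then obtain Q where Q: "Q \<subseteq> E \<union> F" "left_regular (k + 1) Q"
      by (elim exE conjE)
    have "card (P - E) \<le> card (Q - E)" by (rule fewest[OF Q(2)])
    also have "\<dots> \<le> card F" using Q(1) by (intro card_mono) auto
    finally show ?thesis unfolding new .
  qed
  show ?thesis
    by (intro conjI allI impI res added fewest_added)
qed

end
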